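(* Let $K_0(z)$ and $K_1(z)$ denote the second-kind modified Bessel functions of zeroth and first order, respectively. For all $z>0$, $$\frac{\sqrt{z^2+z+1}+1}{z+1}<\frac{K_1(z)}{K_0(z)}<1+\frac{1}{2z}.$$ *)

theory Defs
  imports "HOL-Analysis.Analysis"
begin

text \<open>
  The modified Bessel function of the second kind (Macdonald function) of real order \<open>\<nu>\<close>
  at a positive real argument, given by the classical integral
  \<open>K\<^sub>\<nu>(z) = \<integral>\<^sub>0\<^sup>\<infinity> exp (- z cosh t) cosh (\<nu> t) dt\<close>.
  The value is meaningful for \<open>z > 0\<close> only, where the integral converges absolutely.
\<close>

definition bessel_K :: "real \<Rightarrow> real \<Rightarrow> real" where
  "bessel_K \<nu> z = (LBINT t:{0..}. exp (- z * cosh t) * cosh (\<nu> * t))"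

lemma set_integrable_bessel_K:
  fixes \<nu> z :: real
  assumes z: "z > 0"
  shows "set_integrable lborel {0..} (\<lambda>t. exp (- z * cosh t) * cosh (\<nu> * t))"
proof (rule set_integrable_bound)
  define a where "a = \<bar>\<nu>\<bar> + 1"
  have "(\<lambda>t::real. exp (-1 * t)) absolutely_integrable_on {0..}"
    by (intro nonnegative_absolutely_integrable_1 integrable_on_exp_minus_to_infinity) auto
  hence "set_integrable lborel {0..} (\<lambda>t::real. exp (-1 * t))"
    unfolding set_integrable_def
    by (subst (asm) integrable_completion) (auto intro!: borel_measurable_continuous_onI
          continuous_intros)
  thus "set_integrable lborel {0..} (\<lambda>t::real. exp (a\<^sup>2 / z) * exp (-1 * t))"
    by (rule set_integrable_mult_right)
  have "norm (exp (- z * cosh t) * cosh (\<nu> * t)) \<le> exp (a\<^sup>2 / z) * exp (-1 * t)"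
    if t: "t \<ge> 0" for t
  proof -
    have "t\<^sup>2 / 2 \<le> exp t"
      using exp_lower_Taylor_quadratic[OF t] t by linarith
    hence "t\<^sup>2 / 4 \<le> cosh t"
      by (simp add: cosh_field_def) (use exp_ge_zero[of "-t"] in linarith)
    hence "z * (t\<^sup>2 / 4) \<le> z * cosh t"
      using z by (intro mult_left_mono) auto
    hence 1: "- z * cosh t \<le> - (z * (t\<^sup>2 / 4))"
      by simp
    have "\<bar>\<nu> * t\<bar> = \<bar>\<nu>\<bar> * t"
      using t by (simp add: abs_mult)
    moreover have "cosh \<bar>\<nu> * t\<bar> \<le> exp \<bar>\<nu> * t\<bar>"
      by (simp add: cosh_field_def del: cosh_real_abs)
    ultimately have 2: "cosh (\<nu> * t) \<le> exp (\<bar>\<nu>\<bar> * t)"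
      by (metis cosh_real_abs)
    have "0 \<le> (a - z * t / 2)\<^sup>2 / z"
      using z by simp
    also have "\<dots> = a\<^sup>2 / z - a * t + z * (t\<^sup>2 / 4)"
      using z by (simp add: field_simps power2_eq_square)
    finally have 3: "- (z * (t\<^sup>2 / 4)) + \<bar>\<nu>\<bar> * t \<le> a\<^sup>2 / z + -1 * t"
      by (simp add: a_def algebra_simps)
    have "norm (exp (- z * cosh t) * cosh (\<nu> * t)) = exp (- z * cosh t) * cosh (\<nu> * t)"
      by simp
    also have "\<dots> \<le> exp (- (z * (t\<^sup>2 / 4))) * exp (\<bar>\<nu>\<bar> * t)"
      using 1 2 by (intro mult_mono) auto
    also have "\<dots> = exp (- (z * (t\<^sup>2 / 4)) + \<bar>\<nu>\<bar> * t)"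
      by (rule exp_add [symmetric])
    also have "\<dots> \<le> exp (a\<^sup>2 / z + -1 * t)"
      using 3 by (simp only: exp_le_cancel_iff)
    also have "\<dots> = exp (a\<^sup>2 / z) * exp (-1 * t)"
      by (rule exp_add)
    finally show ?thesis .
  qed
  thus "AE t in lborel. t \<in> {0..} \<longrightarrow>
          norm (exp (- z * cosh t) * cosh (\<nu> * t)) \<le> norm (exp (a\<^sup>2 / z) * exp (-1 * t))"
    by (intro AE_I2) auto
  show "set_borel_measurable lborel {0..} (\<lambda>t. exp (- z * cosh t) * cosh (\<nu> * t))"
    unfolding set_borel_measurable_def
    by (intro borel_measurable_scaleR borel_measurable_indicator)
       (auto intro!: borel_measurable_continuous_onI continuous_intros)
qed

end

theory Submission
  imports Defs
begin

text \<open>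
  Write \<open>w t = exp (- z cosh t)\<close> and \<open>r = K\<^sub>1 z / K\<^sub>0 z\<close>. Integrating the derivative of
  \<open>tanh (t/2) w t\<close> over the half line gives \<open>z (K\<^sub>1 - K\<^sub>0) = \<integral> w / (1 + cosh t)\<close>.
  The upper bound follows from \<open>1 / (1 + cosh t) < 1/2\<close>. For the lower bound, Jensen's inequality
  for the convex function \<open>1 / (1 + x)\<close> and the probability density \<open>w / K\<^sub>0\<close>, under which
  \<open>cosh t\<close> has mean \<open>r\<close>, gives \<open>z (r - 1) \<ge> 1 / (1 + r)\<close>, hence
  \<open>(z + 1) r\<^sup>2 - 2 r - z \<ge> (r - 1)\<^sup>2 > 0\<close>; the claimed lower bound is the positive root
  of this quadratic.
\<close>

text \<open>The endpoint is a null set. This links the closed half line of \<open>bessel_K\<close>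
  to the open one, where strict positivity and the fundamental theorem of calculus are
  applied.\<close>

lemma set_integral_atLeast_eq_greaterThan:
  fixes f :: "real \<Rightarrow> real"
  assumes "set_integrable lborel {a..} f"
  shows "(LBINT t:{a..}. f t) = (LBINT t:{a<..}. f t)"
proof (rule set_integral_cong_set)
  show "set_borel_measurable lborel {a..} f"
    using assms by (simp add: set_integrable_def set_borel_measurable_def)
  have "set_integrable lborel {a<..} f"
    by (rule set_integrable_subset[OF assms]) auto
  then show "set_borel_measurable lborel {a<..} f"
    by (auto simp: set_integrable_def set_borel_measurable_def)
  have "AE t in lborel. t \<noteq> a"
    by (rule AE_lborel_singleton)
  then show "AE t in lborel. (t \<in> {a<..}) = (t \<in> {a..})"
    by eventually_elim auto
qed

text \<open>A nonnegative function with zero integral vanishes almost everywhere, yet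
  \<open>f\<close> is positive on an interval of length 1. Leaving the endpoint out of
  \<open>pos\<close> matters for the upper bound, whose integrand is zero at 0.\<close>

lemma set_integral_half_line_pos:
  fixes f :: "real \<Rightarrow> real"
  assumes int: "set_integrable lborel {a..} f"
    and pos: "\<And>t. t > a \<Longrightarrow> f t > 0"
  shows "(LBINT t:{a..}. f t) > 0"
proof -
  have int': "integrable lborel (\<lambda>t. indicator {a<..} t *\<^sub>R f t)"
    using set_integrable_subset[OF int, of "{a<..}"] unfolding set_integrable_def by force
  have nonneg: "indicator {a<..} t *\<^sub>R f t \<ge> 0" for t
    using pos[of t] by (auto simp: indicator_def)
  have "(LBINT t:{a<..}. f t) \<noteq> 0"
  proof
    assume "(LBINT t:{a<..}. f t) = 0"
    then have "AE t in lborel. indicator {a<..} t *\<^sub>R f t = 0"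
      unfolding set_lebesgue_integral_def
      using integral_nonneg_eq_0_iff_AE[OF int'] nonneg by auto
    then have "AE t in lborel. t \<notin> {a<..<a + 1}"
      by eventually_elim (use pos in \<open>force simp: indicator_def split: if_splits\<close>)
    then have "emeasure lborel {a<..<a + 1} = 0"
      by (subst (asm) AE_iff_measurable[of "{a<..<a + 1}"]) auto
    then show False
      by simp
  qed
  moreover have "(LBINT t:{a<..}. f t) \<ge> 0"
    unfolding set_lebesgue_integral_def by (rule integral_nonneg_AE) (use nonneg in auto)
  ultimately show ?thesis
    by (simp add: set_integral_atLeast_eq_greaterThan[OF int])
qed

lemma bessel_K_0_eq: "bessel_K 0 z = (LBINT t:{0..}. exp (- z * cosh t))"
  by (simp add: bessel_K_def)

lemma bessel_K_1_eq: "bessel_K 1 z = (LBINT t:{0..}. exp (- z * cosh t) * cosh t)"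
  by (simp add: bessel_K_def)

lemma set_integrable_exp_cosh:
  fixes z :: real
  assumes "z > 0"
  shows "set_integrable lborel {0..} (\<lambda>t. exp (- z * cosh t))"
    and "set_integrable lborel {0..} (\<lambda>t. exp (- z * cosh t) * cosh t)"
  using set_integrable_bessel_K[OF assms, of 0] set_integrable_bessel_K[OF assms, of 1] by auto

lemma one_plus_cosh_real_pos: "1 + cosh (t::real) > 0"
  using cosh_real_ge_1[of t] by linarith

lemma set_integrable_exp_cosh_div:
  fixes z :: real
  assumes "z > 0"
  shows "set_integrable lborel {0..} (\<lambda>t. exp (- z * cosh t) / (1 + cosh t))"
proof (rule set_integrable_bound[OF set_integrable_exp_cosh(1)[OF assms]])
  show "set_borel_measurable lborel {0..} (\<lambda>t. exp (- z * cosh t) / (1 + cosh t))"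
    unfolding set_borel_measurable_def
    by (intro borel_measurable_scaleR borel_measurable_indicator)
       (auto intro!: borel_measurable_continuous_onI continuous_intros
             simp: less_imp_neq[OF one_plus_cosh_real_pos, symmetric])
  have "exp (- z * cosh t) / \<bar>1 + cosh t\<bar> \<le> exp (- z * cosh t)" for t
    using cosh_real_ge_1[of t] by (simp add: field_simps)
  then show "AE t in lborel. t \<in> {0..} \<longrightarrow>
      norm (exp (- z * cosh t) / (1 + cosh t)) \<le> norm (exp (- z * cosh t))"
    by simp
qed

lemma bessel_K_diff_eq:
  fixes z :: real
  assumes z: "z > 0"
  shows "z * (bessel_K 1 z - bessel_K 0 z) = (LBINT t:{0..}. exp (- z * cosh t) / (1 + cosh t))"
proof -
  let ?w = "\<lambda>t. exp (- z * cosh t)"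
  \<comment> \<open>The factor \<open>sinh t / (1 + cosh t)\<close> is \<open>tanh (t / 2)\<close>.
    Its derivative is \<open>1 / (1 + cosh t)\<close> and its product with \<open>sinh t\<close> is
    \<open>cosh t - 1\<close>, so \<open>f\<close> is the derivative of \<open>F\<close>.\<close>
  define F where "F = (\<lambda>t. ?w t * (sinh t / (1 + cosh t)))"
  define f where "f = (\<lambda>t. ?w t / (1 + cosh t) - z * (?w t * cosh t - ?w t))"
  note ints = set_integrable_exp_cosh[OF z] set_integrable_exp_cosh_div[OF z]
  have nz: "1 + cosh t \<noteq> 0" for t :: real
    using one_plus_cosh_real_pos[of t] by linarith
  have f_int: "set_integrable lborel {0..} f"
    unfolding f_def by (intro set_integral_diff set_integrable_mult_right ints)
  have s2: "sinh t * sinh t = (cosh t - 1) * (1 + cosh t)" for t :: real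
    using cosh_square_eq[of t] by (simp add: power2_eq_square algebra_simps)
  have deriv: "(F has_real_derivative f t) (at t)" for t
  proof -
    have "(F has_real_derivative
        ?w t * (- z * sinh t) * (sinh t / (1 + cosh t)) +
        ?w t * ((cosh t * (1 + cosh t) - sinh t * sinh t) / ((1 + cosh t) * (1 + cosh t)))) (at t)"
      unfolding F_def by (rule derivative_eq_intros refl nz | simp add: mult.commute)+
    also have "?w t * ((cosh t * (1 + cosh t) - sinh t * sinh t) / ((1 + cosh t) * (1 + cosh t)))
        = ?w t / (1 + cosh t)"
      unfolding s2 using nz[of t] by (simp add: left_diff_distrib[symmetric])
    also have "?w t * (- z * sinh t) * (sinh t / (1 + cosh t))
        = - (z * ?w t * ((sinh t * sinh t) / (1 + cosh t)))"
      by simp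
    also have "\<dots> = - (z * (?w t * cosh t - ?w t))"
      unfolding s2 nonzero_mult_div_cancel_right[OF nz] by (simp add: algebra_simps)
    finally show ?thesis
      by (simp add: f_def)
  qed
  \<comment> \<open>Both boundary values of \<open>F\<close> are 0: at 0 because
    \<open>sinh 0 = 0\<close>, at infinity because \<open>?w\<close> decays while the other factor
    stays bounded by 1.\<close>
  have "LBINT t=0..\<infinity>. f t = 0 - 0"
  proof (rule interval_integral_FTC_integrable[where F = F])
    show "(F has_vector_derivative f t) (at t)" for t
      using deriv by (simp add: has_real_derivative_iff_has_vector_derivative)
    show "isCont f t" for t
      unfolding f_def by (intro continuous_intros) (use nz in auto)
    show "set_integrable lborel (einterval 0 \<infinity>) f"
      by (rule set_integrable_subset[OF f_int]) (auto simp: einterval_def)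
    have "isCont F 0"
      using deriv by (rule DERIV_isCont)
    then have "(F \<longlongrightarrow> 0) (at_right 0)"
      by (auto simp: isCont_def F_def intro: filterlim_mono[OF _ order_refl at_le])
    then show "((F \<circ> real_of_ereal) \<longlongrightarrow> 0) (at_right 0)"
      by (simp add: zero_ereal_def ereal_tendsto_simps)
    have "(F \<longlongrightarrow> 0) at_top"
    proof (rule Lim_null_comparison)
      show "\<forall>\<^sub>F t in at_top. norm (F t) \<le> ?w t"
      proof (rule always_eventually, rule allI)
        fix t :: real
        have "\<bar>sinh t\<bar> \<le> 1 + cosh t"
          by (simp add: sinh_field_def cosh_field_def abs_le_iff field_simps)
        then have "\<bar>sinh t / (1 + cosh t)\<bar> \<le> 1"
          using one_plus_cosh_real_pos[of t] by simp
        then show "norm (F t) \<le> ?w t"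
          using mult_left_le[of "\<bar>sinh t / (1 + cosh t)\<bar>" "?w t"] by (simp add: F_def abs_mult)
      qed
      have "filterlim (\<lambda>t. z * cosh t) at_top at_top"
        by (intro filterlim_tendsto_pos_mult_at_top[OF tendsto_const z] cosh_real_at_top)
      then show "((\<lambda>t. ?w t) \<longlongrightarrow> 0) at_top"
        by (intro filterlim_compose[OF exp_at_bot]) (simp add: filterlim_uminus_at_top)
    qed
    then show "((F \<circ> real_of_ereal) \<longlongrightarrow> 0) (at_left \<infinity>)"
      by (simp add: ereal_tendsto_simps)
  qed auto
  then have "(LBINT t:{0<..}. f t) = 0"
    by (simp add: interval_integral_to_infinity_eq zero_ereal_def)
  moreover have "(LBINT t:{0..}. f t) = (LBINT t:{0<..}. f t)"
    by (rule set_integral_atLeast_eq_greaterThan[OF f_int])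
  moreover have "(LBINT t:{0..}. f t)
      = (LBINT t:{0..}. ?w t / (1 + cosh t)) - z * (bessel_K 1 z - bessel_K 0 z)"
    unfolding f_def bessel_K_0_eq bessel_K_1_eq
    using ints by (simp add: set_integral_diff)
  ultimately show ?thesis
    by simp
qed

lemma bessel_K_0_pos:
  assumes "z > 0"
  shows "bessel_K 0 z > 0"
  unfolding bessel_K_0_eq
  by (rule set_integral_half_line_pos[OF set_integrable_exp_cosh(1)[OF assms]]) auto

lemma bessel_K_1_pos:
  assumes "z > 0"
  shows "bessel_K 1 z > 0"
  unfolding bessel_K_1_eq
  by (rule set_integral_half_line_pos[OF set_integrable_exp_cosh(2)[OF assms]]) auto

text \<open>For \<open>t > 0\<close> the weight \<open>1 / (1 + cosh t)\<close> is below 1/2, so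
  \<open>bessel_K_diff_eq\<close> bounds \<open>z * (bessel_K 1 z - bessel_K 0 z)\<close> strictly
  by half of \<open>bessel_K 0 z\<close>.\<close>

lemma bessel_K_ratio_upper:
  fixes z :: real
  assumes z: "z > 0"
  shows "bessel_K 1 z / bessel_K 0 z < 1 + 1 / (2 * z)"
proof -
  let ?w = "\<lambda>t. exp (- z * cosh t)"
  note ints = set_integrable_exp_cosh[OF z] set_integrable_exp_cosh_div[OF z]
  have "(LBINT t:{0..}. ?w t * (1 / 2) - ?w t / (1 + cosh t)) > 0"
  proof (rule set_integral_half_line_pos)
    show "?w t * (1 / 2) - ?w t / (1 + cosh t) > 0" if "t > 0" for t
    proof -
      have "cosh t > 1"
        using cosh_real_strict_mono[of 0 t] that by simp
      then show ?thesis
        by (simp add: field_simps)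
    qed
  qed (intro set_integral_diff set_integrable_mult_left ints)
  also have "(LBINT t:{0..}. ?w t * (1 / 2) - ?w t / (1 + cosh t))
      = bessel_K 0 z * (1 / 2) - z * (bessel_K 1 z - bessel_K 0 z)"
    unfolding bessel_K_diff_eq[OF z] unfolding bessel_K_0_eq
    by (subst set_integral_diff(2)) (intro set_integrable_mult_left ints | simp)+
  finally show ?thesis
    using z bessel_K_0_pos[OF z] by (simp add: field_simps)
qed

text \<open>Jensen's inequality in tangent form: a tangent of the convex function
  \<open>1 / (1 + x)\<close>, evaluated at \<open>cosh t\<close>, is integrated against
  \<open>?w\<close>.\<close>

lemma bessel_K_ratio_square_ge:
  fixes z :: real
  assumes z: "z > 0"
  shows "z * ((bessel_K 1 z / bessel_K 0 z)\<^sup>2 - 1) \<ge> 1"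
proof -
  let ?w = "\<lambda>t. exp (- z * cosh t)"
  define r where "r = bessel_K 1 z / bessel_K 0 z"
  note ints = set_integrable_exp_cosh[OF z] set_integrable_exp_cosh_div[OF z]
  have K0: "bessel_K 0 z > 0"
    by (rule bessel_K_0_pos[OF z])
  have r: "r > 0"
    using K0 bessel_K_1_pos[OF z] by (simp add: r_def)
  have K1: "bessel_K 1 z = r * bessel_K 0 z"
    using K0 by (simp add: r_def)
  \<comment> \<open>the tangent of \<open>1 / (1 + x)\<close> at \<open>x = r\<close>\<close>
  define a b where "a = 1 / (1 + r) + r / (1 + r)\<^sup>2" and "b = 1 / (1 + r)\<^sup>2"
  have tangent: "a - b * x \<le> 1 / (1 + x)" if "x > 0" for x
  proof -
    \<comment> \<open>The gap between the function and its tangent is an explicit square over a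
      positive denominator, so no convexity theory is required.\<close>
    have "1 / (1 + x) - (a - b * x) = (x - r)\<^sup>2 / ((1 + r)\<^sup>2 * (1 + x))"
      using r that unfolding a_def b_def
      by (simp add: divide_simps add_pos_pos add_nonneg_eq_0_iff) algebra
    also have "\<dots> \<ge> 0"
      using r that by simp
    finally show ?thesis
      by simp
  qed
  have "(LBINT t:{0..}. ?w t * a - ?w t * cosh t * b) \<le> (LBINT t:{0..}. ?w t / (1 + cosh t))"
  proof (rule set_integral_mono)
    show "?w t * a - ?w t * cosh t * b \<le> ?w t / (1 + cosh t)" for t
      using mult_left_mono[OF tangent[of "cosh t"], of "?w t"] by (simp add: algebra_simps)
  qed (intro set_integral_diff set_integrable_mult_left ints)+
  also have "(LBINT t:{0..}. ?w t * a - ?w t * cosh t * b) = bessel_K 0 z * a - bessel_K 1 z * b"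
    unfolding bessel_K_0_eq bessel_K_1_eq
    by (subst set_integral_diff(2)) (intro set_integrable_mult_left ints | simp)+
  \<comment> \<open>Touching at the mean \<open>r\<close> leaves only the tangent's value there:
    \<open>a - b * r = 1 / (1 + r)\<close>.\<close>
  also have "\<dots> = bessel_K 0 z / (1 + r)"
    unfolding K1 a_def b_def by (simp add: algebra_simps)
  also have "(LBINT t:{0..}. ?w t / (1 + cosh t)) = bessel_K 0 z * (z * (r - 1))"
    unfolding bessel_K_diff_eq[OF z, symmetric] K1 by (simp add: algebra_simps)
  finally have "1 / (1 + r) \<le> z * (r - 1)"
    using K0 by (simp add: divide_inverse)
  then have "1 \<le> z * (r - 1) * (1 + r)"
    using r by (simp add: pos_divide_le_eq)
  then show ?thesis
    by (simp add: r_def[symmetric] power2_eq_square algebra_simps)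
qed

lemma bessel_K_ratio_lower:
  fixes z :: real
  assumes z: "z > 0"
  shows "(sqrt (z\<^sup>2 + z + 1) + 1) / (z + 1) < bessel_K 1 z / bessel_K 0 z"
proof -
  define r where "r = bessel_K 1 z / bessel_K 0 z"
  have ge: "z * (r\<^sup>2 - 1) \<ge> 1"
    using bessel_K_ratio_square_ge[OF z] by (simp add: r_def)
  have r0: "r > 0"
    using bessel_K_0_pos[OF z] bessel_K_1_pos[OF z] by (simp add: r_def)
  have "z * (r\<^sup>2 - 1) > 0"
    using ge by linarith
  then have "1 < r\<^sup>2"
    using z by (simp add: zero_less_mult_iff)
  then have r1: "r > 1"
    using r0 power2_less_imp_less[of 1 r] by simp
  \<comment> \<open>The Jensen bound is not strict; strictness enters here, through
    \<open>r > 1\<close>.\<close>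
  have "(r - 1)\<^sup>2 > 0"
    using r1 by simp
  then have "(z + 1) * r\<^sup>2 - 2 * r > z"
    using ge by (simp add: power2_eq_square algebra_simps)
  \<comment> \<open>Scaling by \<open>z + 1\<close> prepares for completing the square in
    \<open>(z + 1) * r\<close>.\<close>
  then have "(z + 1) * ((z + 1) * r\<^sup>2 - 2 * r) > (z + 1) * z"
    using z by simp
  then have "z\<^sup>2 + z + 1 < ((z + 1) * r - 1)\<^sup>2"
    by (simp add: power2_eq_square algebra_simps)
  \<comment> \<open>This makes \<open>(z + 1) * r - 1\<close> nonnegative, as taking square roots
    requires.\<close>
  moreover have "1 * 1 \<le> (z + 1) * r"
    using z r1 by (intro mult_mono) auto
  ultimately have "sqrt (z\<^sup>2 + z + 1) < (z + 1) * r - 1"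
    by (intro real_less_lsqrt) auto
  then show ?thesis
    using z by (simp add: r_def[symmetric] field_simps)
qed

theorem lemma2p8:
  fixes z :: real
  assumes "z > 0"
  shows "(sqrt (z\<^sup>2 + z + 1) + 1) / (z + 1) < bessel_K 1 z / bessel_K 0 z
       \<and> bessel_K 1 z / bessel_K 0 z < 1 + 1 / (2 * z)"
  using bessel_K_ratio_lower[OF assms] bessel_K_ratio_upper[OF assms] by blast

end
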